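(* Let $T$ be a tree with a root vertex $v_0$ that has degree $k-1 \geq 3$ for some even integer $k \geq 4$, and suppose that $T$ has exactly $2k-1$ vertices each of which has degree $k+1$. Let $V$ be the set of all vertices of $T$, and $F = \{v \in V \mid \deg(v) = k+1\}$. Suppose that one vertex in $F$ is adjacent to $k$ vertices in $F$, and that every vertex adjacent to $v_0$ has degree $k+1$. Suppose that all other vertices of $T$ (other than $v_0$ and the vertices in $F$) are of degree $1$. Then $T$ can be represented as (is graph-isomorphic to) $k\text{-}G(Z_n)$, where $n = 2k^2$. Furthermore, $\operatorname{diam}(T) = 5$.
   Context: $Z_n$ is the additive cyclic group of integers modulo $n$. For an integer $r>1$, the graph $r\text{-}G(Z_n)$ is the simple undirected graph with vertex set $Z_n$ in which two distinct vertices $a,b$ are adjacent if and only if $ra=b$ or $rb=a$ in $Z_n$. The diameter of a graph is the maximum of the distances (lengths of shortest paths) over all pairs of vertices.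
   Formalization: "One vertex in F is adjacent to k vertices in F" is read as: one vertex in F has k children in F, in the tree rooted at v_0; with plain adjacency (the parent counted) the claim fails, since a tree of diameter 6 also meets the hypotheses. *)

theory Defs
  imports "Graph_Theory.Graph_Theory" "HOL-Number_Theory.Cong"
begin

text \<open>
  An undirected simple graph is a symmetric loop-free digraph on pairs
  (\<open>pair_bidirected_digraph\<close>): the edge \<open>uv\<close> is the pair of arcs \<open>(u, v)\<close>, \<open>(v, u)\<close>.
  Finiteness is not assumed.
\<close>

abbreviation gdegree :: "'a pair_pre_digraph \<Rightarrow> 'a \<Rightarrow> nat" where
  "gdegree G v \<equiv> out_degree (with_proj G) v"

text \<open>
  The library predicate \<open>tree\<close> is unusable here, since it counts \<open>u, v, u\<close> as a cycle of a
  symmetric digraph; an undirected cycle is a cycle of length at least 3.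
\<close>

definition undirected_tree :: "'a pair_pre_digraph \<Rightarrow> bool" where
  "undirected_tree T \<longleftrightarrow>
     pair_bidirected_digraph T \<and>
     Digraph_Component.connected (with_proj T) \<and>
     \<not> (\<exists>p. pre_digraph.cycle (with_proj T) p \<and> 3 \<le> length p)"

text \<open>
  Children in a tree rooted at \<open>r\<close>: \<open>w\<close> is a child of \<open>u\<close> iff the path from \<open>r\<close> to \<open>w\<close>
  arrives at \<open>w\<close> through the edge \<open>uw\<close>.

  In the theorem, the vertex of \<open>F\<close> that is adjacent to \<open>k\<close> vertices of \<open>F\<close> is read in the
  tree oriented away from the root, as having \<open>k\<close> children in \<open>F\<close>.  With undirected adjacency
  the claim fails: let \<open>w\<close> be a neighbour of \<open>v0\<close> with a child \<open>u\<close> of degree \<open>k + 1\<close>, let \<open>u\<close>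
  have \<open>k - 1\<close> children of degree \<open>k + 1\<close> and one leaf, and fill up with leaves.  Then \<open>u\<close> has
  \<open>k\<close> neighbours in \<open>F\<close> and all other hypotheses hold, but the diameter is 6.
\<close>

definition children :: "'a pair_pre_digraph \<Rightarrow> 'a \<Rightarrow> 'a \<Rightarrow> 'a set" where
  "children T r u = {w. \<exists>p. pre_digraph.apath (with_proj T) r (p @ [(u, w)]) w}"

definition gdist :: "'a pair_pre_digraph \<Rightarrow> 'a \<Rightarrow> 'a \<Rightarrow> ereal" where
  "gdist G u v = wf_digraph.\<mu> (with_proj G) (\<lambda>_. 1) u v"

definition diameter :: "'a pair_pre_digraph \<Rightarrow> ereal" where
  "diameter G = (SUP u\<in>pverts G. SUP v\<in>pverts G. gdist G u v)"

text \<open>\<open>Z_n\<close> is represented by the residues \<open>0, \<dots>, n - 1\<close>.\<close>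

definition rG_Z :: "nat \<Rightarrow> nat \<Rightarrow> int pair_pre_digraph" where
  "rG_Z r n = \<lparr> pverts = {0..<int n},
     parcs = {(a, b). a \<in> {0..<int n} \<and> b \<in> {0..<int n} \<and> a \<noteq> b \<and>
               ([int r * a = b] (mod int n) \<or> [int r * b = a] (mod int n))} \<rparr>"

end

theory Submission
  imports Defs
begin

text \<open>
  A rooted tree is recovered from its parent map \<open>p\<close>: the edges are the pairs \<open>{x, p x}\<close> for
  \<open>x\<close> other than the root.  The edges of \<open>k\<close>-\<open>G(Z_n)\<close> are by definition the pairs
  \<open>{x, k x}\<close>, so for \<open>n = 2k\<^sup>2\<close> multiplication by \<open>k\<close> is a candidate for a parent map with
  root \<open>0\<close>.  The proof compares the two graphs through their parent maps, whose fibres are the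
  sets of children (\<open>kids\<close>).

  In \<open>T\<close>, counting fixes the shape.  The \<open>k - 1\<close> children of \<open>v0\<close> lie in \<open>F\<close>.  The vertex \<open>u\<close>
  of \<open>F\<close> with \<open>k\<close> children in \<open>F\<close> contributes \<open>k\<close> further members, and the \<open>2k - 1\<close> vertices
  found in this way exhaust \<open>F\<close>.  Hence \<open>u\<close>, being in \<open>F\<close> but not among its own children, is a
  child of \<open>v0\<close>.  All vertices of \<open>F\<close> have \<open>k\<close> children, and every
  vertex outside \<open>F\<close> other than \<open>v0\<close> is a leaf; its parent is a member of \<open>F\<close> other than \<open>u\<close>.
  This is the locale \<open>branched_tree\<close>.

  In \<open>Z_n\<close>, the congruence \<open>k x = k m\<close> modulo \<open>2k\<^sup>2\<close> means \<open>x = m\<close> modulo \<open>2k\<close>.  So every multiple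
  of \<open>k\<close> has \<open>k\<close> preimages (\<open>0\<close> counts itself as one of them), and other residues have none.
  Since \<open>k\<^sup>2 x\<close> is \<open>0\<close> or \<open>k\<^sup>2\<close> according to the parity of \<open>x\<close>, two steps lead from any
  residue to \<open>0\<close> or to \<open>k\<^sup>2\<close>, and \<open>k\<^sup>2\<close> is a child of \<open>0\<close> because \<open>k\<close> is even.
  This is the same shape, with \<open>u = k\<^sup>2\<close> (\<open>branched_tree_rG_Z\<close>).

  The shape determines the graph (\<open>digraph_iso_branched_trees\<close>): a bijection between the sets
  \<open>{root, u}\<close> extends level by level, because corresponding vertices have equally many children.
  It also determines the diameter (\<open>diameter_5\<close>): a vertex in the third level, necessarily below
  \<open>u\<close>, and a vertex in the second level below another child of the root have distance \<open>5\<close>, and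
  two vertices in the third level meet already at \<open>u\<close>.
\<close>

section \<open>Graphs given by a parent map\<close>

text \<open>
  The root is its own parent, so that iterates of \<open>p\<close> are defined everywhere and stay at the root.
\<close>

locale rooted_parents =
  fixes G :: "'a pair_pre_digraph" and r :: 'a and p :: "'a \<Rightarrow> 'a"
  assumes root_in: "r \<in> pverts G"
    and parent_root: "p r = r"
    and parent_in: "x \<in> pverts G \<Longrightarrow> p x \<in> pverts G"
    and parcs_parent: "parcs G = {(x, y). x \<in> pverts G \<and> y \<in> pverts G \<and>
      (x \<noteq> r \<and> y = p x \<or> y \<noteq> r \<and> x = p y)}"
begin

definition kids :: "'a \<Rightarrow> 'a set" where
  "kids y = {x \<in> pverts G - {r}. p x = y}"

sublocale pair_sym_digraph G
proof
  show "fst e \<in> pverts G" if "e \<in> parcs G" for e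
    using that unfolding parcs_parent by auto
  show "snd e \<in> pverts G" if "e \<in> parcs G" for e
    using that unfolding parcs_parent by auto
  show "symmetric (with_proj G)"
    unfolding symmetric_def by (auto simp: parcs_parent intro: symI)
qed

text \<open>Only a bound on the length can hold, since the iteration may stall at the root.\<close>

lemma walk_up: "x \<in> pverts G \<Longrightarrow> \<exists>q. awalk x q ((p ^^ m) x) \<and> length q \<le> m"
proof (induction m)
  case 0
  then show ?case by (auto intro!: exI[of _ "[]"] simp: awalk_Nil_iff)
next
  case (Suc m)
  then obtain q where q: "awalk x q ((p ^^ m) x)" "length q \<le> m" by blast
  let ?y = "(p ^^ m) x"
  have y: "?y \<in> pverts G" using q(1) by (rule awalk_last_in_verts)
  show ?case
  proof (cases "?y = r")
    case True
    then show ?thesis using q parent_root by (auto intro!: exI[of _ q])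
  next
    case False
    have "(?y, p ?y) \<in> parcs G" using y False parent_in by (auto simp: parcs_parent)
    then have "awalk ?y [(?y, p ?y)] (p ?y)"
      using arc_implies_awalk by fastforce
    from awalk_appendI[OF q(1) this] q(2) show ?thesis
      by (intro exI[of _ "q @ [(?y, p ?y)]"]) simp
  qed
qed

lemma length_rev_path: "length (rev_path q) = length q"
  by (induction q) auto

lemma awalk_cost_length: "awalk_cost (\<lambda>_. 1) q = real (length q)"
  by (induction q) auto

lemma gdist_le_common_ancestor:
  assumes "x \<in> pverts G" "y \<in> pverts G" "(p ^^ m) x = (p ^^ n) y"
  shows "gdist G x y \<le> ereal (m + n)"
proof -
  obtain q where q: "awalk x q ((p ^^ m) x)" "length q \<le> m"
    using walk_up assms(1) by blast
  obtain q' where q': "awalk y q' ((p ^^ m) x)" "length q' \<le> n"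
    using walk_up assms(2,3) by metis
  have "awalk x (q @ rev_path q') y"
    using q(1) q'(1) by (intro awalk_appendI) auto
  then have "gdist G x y \<le> ereal (awalk_cost (\<lambda>_. 1) (q @ rev_path q'))"
    unfolding gdist_def by (rule min_cost_le_walk_cost)
  also have "\<dots> \<le> ereal (m + n)"
    using q(2) q'(2) unfolding awalk_cost_length by (simp add: length_rev_path)
  finally show ?thesis .
qed

text \<open>A potential that changes by at most one along each edge bounds distances from below.\<close>

lemma gdist_ge_potential:
  fixes h :: "'a \<Rightarrow> int"
  assumes "\<And>x. x \<in> pverts G \<Longrightarrow> x \<noteq> r \<Longrightarrow> \<bar>h x - h (p x)\<bar> \<le> 1"
  shows "ereal (h x - h y) \<le> gdist G x y"
proof -
  have arc: "h a - h b \<le> 1" if "(a, b) \<in> parcs G" for a b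
    using that assms[of a] assms[of b] unfolding parcs_parent by auto
  have "h x - h y \<le> length q" if "awalk x q y" for q
    using that
  proof (induction q arbitrary: x)
    case Nil
    then show ?case by (simp add: awalk_Nil_iff)
  next
    case (Cons e q)
    obtain a b where e: "e = (a, b)" by fastforce
    have "awalk b q y" "(x, b) \<in> parcs G" using Cons.prems e by (auto simp: awalk_Cons_iff)
    then show ?case using Cons.IH[of b] arc[of x b] by simp
  qed
  then have "real_of_int (h x - h y) \<le> real (length q)" if "awalk x q y" for q
    using that by (metis of_int_le_iff of_int_of_nat_eq)
  then show ?thesis
    unfolding gdist_def \<mu>_def by (intro INF_greatest) (auto simp: awalk_cost_length)
qed

end

section \<open>Trees in which one child of the root branches further\<close>

text \<open>
  The vertices with children are the root, its children and the children of the distinguished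
  child \<open>u\<close>; all others are attached to such a vertex, but not to the root or to \<open>u\<close>.
\<close>

locale branched_tree = rooted_parents +
  fixes u :: 'a and k :: nat
  assumes k: "3 \<le> k"
    and hub: "u \<in> kids r"
    and card_root: "card (kids r) = k - 1"
    and card_hub: "card (kids u) = k"
    and card_inner: "v \<in> kids r - {u} \<union> kids u \<Longrightarrow> card (kids v) = k"
    and deep: "x \<in> pverts G - {r} \<Longrightarrow> x \<notin> kids r \<union> kids u \<Longrightarrow> p x \<in> kids r - {u} \<union> kids u"
begin

lemma hub_simps: "u \<in> pverts G" "u \<noteq> r" "p u = r"
  using hub by (auto simp: kids_def)

lemma gdist_le_5:
  assumes "x \<in> pverts G" "y \<in> pverts G"
  shows "gdist G x y \<le> 5"
proof -
  have two: "(p ^^ 2) z = r \<or> (p ^^ 2) z = u" if z: "z \<in> pverts G" for z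
  proof -
    consider "z = r" | "p z = r" | "p z = u" | "p (p z) = r" | "p (p z) = u"
      using deep[of z] z unfolding kids_def by blast
    then show ?thesis
      by cases (simp_all add: numeral_2_eq_2 hub_simps parent_root)
  qed
  have three: "(p ^^ 3) z = p ((p ^^ 2) z)" for z by (simp add: eval_nat_numeral)
  \<comment> \<open>Both reach the same vertex after two steps, or one of them reaches \<open>u\<close>, a child of the root
    that the other has reached.\<close>
  have "\<exists>m n. m + n \<le> 5 \<and> (p ^^ m) x = (p ^^ n) y"
  proof -
    consider "(p ^^ 2) x = (p ^^ 2) y" | "(p ^^ 2) x = (p ^^ 3) y" | "(p ^^ 3) x = (p ^^ 2) y"
      using two[OF assms(1)] two[OF assms(2)] three hub_simps(3) by metis
    then show ?thesis
    proof cases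
      case 1 then show ?thesis by (intro exI[of _ 2]) simp
    next
      case 2 then show ?thesis by (intro exI[of _ 2] exI[of _ 3]) simp
    next
      case 3 then show ?thesis by (intro exI[of _ 3] exI[of _ 2]) simp
    qed
  qed
  then obtain m n where mn: "m + n \<le> 5" "(p ^^ m) x = (p ^^ n) y" by blast
  have "gdist G x y \<le> ereal (m + n)" using gdist_le_common_ancestor[OF assms mn(2)] .
  also have "ereal (m + n) \<le> 5" using mn(1) by simp
  finally show ?thesis .
qed

lemma gdist_5: "\<exists>x\<in>pverts G. \<exists>y\<in>pverts G. 5 \<le> gdist G x y"
proof -
  have ex: "\<exists>x. x \<in> kids v" if "card (kids v) = k" for v
    using that k by (metis card.empty ex_in_conv not_numeral_le_zero)
  obtain c where c: "c \<in> kids u" using ex[OF card_hub] by blast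
  obtain x where x: "x \<in> kids c" using ex card_inner c by blast
  have "\<not> kids r \<subseteq> {u}" using card_root k card_mono[of "{u}" "kids r"] by auto
  then obtain w where w: "w \<in> kids r - {u}" by blast
  obtain y where y: "y \<in> kids w" using ex card_inner w by blast
  \<comment> \<open>The depth, counted positively on the subtree below \<open>u\<close> and negatively elsewhere.\<close>
  define h :: "'a \<Rightarrow> int" where "h v =
    (if v = r then 0 else if v = u then 1 else if p v = u then 2 else if p (p v) = u then 3
     else if p v = r then -1 else -2)" for v
  have "\<bar>h v - h (p v)\<bar> \<le> 1" if v: "v \<in> pverts G" "v \<noteq> r" for v
  proof -
    consider "v \<in> kids r" | "v \<in> kids u" | "p v \<in> kids r - {u}" "p v \<noteq> u" | "p v \<in> kids u"
      using deep[of v] v by blast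
    then show ?thesis
      by cases (use hub_simps parent_root v in \<open>auto simp: h_def kids_def\<close>)
  qed
  then have "ereal (h x - h y) \<le> gdist G x y" by (rule gdist_ge_potential)
  moreover have "h x = 3" "h y = -2"
    using c x w y hub_simps parent_root by (auto simp: h_def kids_def)
  ultimately have "5 \<le> gdist G x y" by simp
  then show ?thesis using x y unfolding kids_def by blast
qed

lemma diameter_5: "diameter G = 5"
proof (rule antisym)
  show "diameter G \<le> 5"
    unfolding diameter_def by (intro SUP_least gdist_le_5)
  obtain x y where xy: "x \<in> pverts G" "y \<in> pverts G" "5 \<le> gdist G x y" using gdist_5 by blast
  then show "5 \<le> diameter G"
    unfolding diameter_def by (intro SUP_upper2[OF xy(1)] SUP_upper2[OF xy(2)])
qed

end

section \<open>The shape determines the graph\<close>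

text \<open>
  One level of the construction of an isomorphism: the fibres of the parent maps over corresponding
  vertices are matched by arbitrary bijections, which together match the new levels \<open>N\<close> and \<open>N'\<close>.
\<close>

lemma extend_bij_along_fibres:
  assumes f: "bij_betw f S S'"
    and new: "N \<inter> S = {}" "N' \<inter> S' = {}"
    and p: "p ` N \<subseteq> S" "p' ` N' \<subseteq> S'"
    and fin: "\<And>y. y \<in> S \<Longrightarrow> finite {x \<in> N. p x = y}" "\<And>y. y \<in> S \<Longrightarrow> finite {x \<in> N'. p' x = f y}"
    and card: "\<And>y. y \<in> S \<Longrightarrow> card {x \<in> N. p x = y} = card {x \<in> N'. p' x = f y}"
  obtains g where "bij_betw g (S \<union> N) (S' \<union> N')" "\<And>x. x \<in> S \<Longrightarrow> g x = f x"
    "\<And>x. x \<in> N \<Longrightarrow> p' (g x) = g (p x)"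
proof -
  have "\<forall>y. \<exists>h. y \<in> S \<longrightarrow> bij_betw h {x \<in> N. p x = y} {x \<in> N'. p' x = f y}"
  proof (intro allI)
    fix y
    show "\<exists>h. y \<in> S \<longrightarrow> bij_betw h {x \<in> N. p x = y} {x \<in> N'. p' x = f y}"
    proof (cases "y \<in> S")
      case True
      then show ?thesis
        using finite_same_card_bij[OF fin(1) fin(2) card] by blast
    qed simp
  qed
  then obtain h where h: "\<And>y. y \<in> S \<Longrightarrow> bij_betw (h y) {x \<in> N. p x = y} {x \<in> N'. p' x = f y}"
    by metis
  define g where "g x = (if x \<in> S then f x else h (p x) x)" for x
  have hN: "h (p x) x \<in> N'" "p' (h (p x) x) = f (p x)" if "x \<in> N" for x
    using h[of "p x"] p that by (auto simp: bij_betw_def)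
  have gN: "g x = h (p x) x" if "x \<in> N" for x using that new by (auto simp: g_def)
  have "bij_betw g S S'" using f by (subst bij_betw_cong[of _ _ f]) (auto simp: g_def)
  moreover have "bij_betw g N N'"
  proof (rule bij_betw_imageI)
    show "inj_on g N"
    proof (rule inj_onI)
      fix x y assume xy: "x \<in> N" "y \<in> N" "g x = g y"
      then have eq: "h (p x) x = h (p y) y" by (simp add: gN)
      then have "f (p x) = f (p y)" using hN xy by metis
      then have "p x = p y" using inj_onD[OF bij_betw_imp_inj_on[OF f]] p xy by blast
      then show "x = y" using eq h[of "p x"] p xy by (auto simp: bij_betw_def inj_on_def)
    qed
    show "g ` N = N'"
    proof
      show "g ` N \<subseteq> N'" using hN gN by auto
      show "N' \<subseteq> g ` N"
      proof
        fix z assume z: "z \<in> N'"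
        then obtain y where y: "y \<in> S" "p' z = f y" using f p by (auto simp: bij_betw_def)
        then have "z \<in> h y ` {x \<in> N. p x = y}" using h[OF y(1)] z by (auto simp: bij_betw_def)
        then show "z \<in> g ` N" using gN by auto
      qed
    qed
  qed
  ultimately have "bij_betw g (S \<union> N) (S' \<union> N')"
    using new by (intro bij_betw_combine) auto
  moreover have "p' (g x) = g (p x)" if "x \<in> N" for x
    using hN(2)[OF that] gN[OF that] p that by (auto simp: g_def)
  ultimately show thesis using that g_def by auto
qed

lemma digraph_iso_parents:
  assumes "rooted_parents G r p" "rooted_parents G' r' p'"
    and f: "bij_betw f (pverts G) (pverts G')" "f r = r'"
    and comm: "\<And>x. x \<in> pverts G \<Longrightarrow> p' (f x) = f (p x)"
  shows "digraph_iso (with_proj G) (with_proj G')"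
proof -
  interpret A: rooted_parents G r p by fact
  interpret B: rooted_parents G' r' p' by fact
  define hom where "hom = \<lparr>iso_verts = f, iso_arcs = map_prod f f, iso_head = snd, iso_tail = fst\<rparr>"
  have inj: "inj_on f (pverts G)" and img: "f ` pverts G = pverts G'"
    using f(1) by (auto simp: bij_betw_def)
  have eq: "f x = f y \<longleftrightarrow> x = y" if "x \<in> pverts G" "y \<in> pverts G" for x y
    using inj that by (auto dest: inj_onD)
  have arc: "(f x, f y) \<in> parcs G' \<longleftrightarrow> (x, y) \<in> parcs G" if "x \<in> pverts G" "y \<in> pverts G" for x y
  proof -
    have "f x \<noteq> r' \<longleftrightarrow> x \<noteq> r" "f y \<noteq> r' \<longleftrightarrow> y \<noteq> r"
      using that f(2) eq A.root_in by auto
    moreover have "f y = p' (f x) \<longleftrightarrow> y = p x" "f x = p' (f y) \<longleftrightarrow> x = p y"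
      using that comm eq A.parent_in by auto
    moreover have "f x \<in> pverts G'" "f y \<in> pverts G'" using that img by auto
    ultimately show ?thesis using that unfolding A.parcs_parent B.parcs_parent by auto
  qed
  have "parcs G' = map_prod f f ` parcs G"
  proof
    show "map_prod f f ` parcs G \<subseteq> parcs G'"
      using arc by (auto dest: A.in_arcsD1 A.in_arcsD2)
    show "parcs G' \<subseteq> map_prod f f ` parcs G"
    proof
      fix e assume e: "e \<in> parcs G'"
      obtain a b where ab: "e = (a, b)" by fastforce
      obtain x y where xy: "x \<in> pverts G" "y \<in> pverts G" "a = f x" "b = f y"
        using e ab img B.in_arcsD1 B.in_arcsD2 by (metis imageE)
      then have "(x, y) \<in> parcs G" using arc e ab by blast
      then show "e \<in> map_prod f f ` parcs G" using ab xy by (auto intro!: image_eqI[of _ _ "(x, y)"])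
    qed
  qed
  then have "with_proj G' = app_iso hom (with_proj G)"
    by (simp add: app_iso_def hom_def with_proj_def img)
  moreover have "inj_on (map_prod f f) (parcs G)"
    by (rule inj_on_subset[OF map_prod_inj_on[OF inj inj]]) (auto dest: A.in_arcsD1 A.in_arcsD2)
  then have "pre_digraph.digraph_isomorphism (with_proj G) hom"
    unfolding pre_digraph.digraph_isomorphism_def using inj A.wf_digraph_axioms
    by (auto simp: hom_def)
  ultimately show ?thesis unfolding digraph_iso_def by blast
qed

text \<open>
  The extension starts from \<open>{r, u}\<close> instead of \<open>{r}\<close>, so that \<open>u\<close> is certain to be mapped to
  \<open>u'\<close>.  Two extensions suffice: to the remaining vertices with children (\<open>N\<close>) and to the leaves
  below them (\<open>M\<close>).
\<close>

lemma digraph_iso_branched_trees: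
  assumes "branched_tree G r p u k" "branched_tree G' r' p' u' k"
  shows "digraph_iso (with_proj G) (with_proj G')"
proof -
  interpret A: branched_tree G r p u k by fact
  interpret B: branched_tree G' r' p' u' k by fact
  note Ah = A.hub_simps and Bh = B.hub_simps
  define f where "f x = (if x = r then r' else u')" for x
  have f: "bij_betw f {r, u} {r', u'}"
    using Ah Bh by (auto simp: f_def bij_betw_def inj_on_def)
  define N where "N = A.kids r - {u} \<union> A.kids u"
  define N' where "N' = B.kids r' - {u'} \<union> B.kids u'"
  have fin: "finite (A.kids y)" if "y \<in> {r, u} \<union> N" for y
    using that A.card_root A.card_hub A.card_inner[of y] A.k unfolding N_def
    by (intro card_ge_0_finite) auto
  have fin': "finite (B.kids y)" if "y \<in> {r', u'} \<union> N'" for y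
    using that B.card_root B.card_hub B.card_inner[of y] B.k unfolding N'_def
    by (intro card_ge_0_finite) auto
  have fib: "{x \<in> N. p x = r} = A.kids r - {u}" "{x \<in> N. p x = u} = A.kids u"
    using Ah by (auto simp: N_def A.kids_def)
  have fib': "{x \<in> N'. p' x = r'} = B.kids r' - {u'}" "{x \<in> N'. p' x = u'} = B.kids u'"
    using Bh by (auto simp: N'_def B.kids_def)
  obtain g where g: "bij_betw g ({r, u} \<union> N) ({r', u'} \<union> N')"
    "\<And>x. x \<in> {r, u} \<Longrightarrow> g x = f x" "\<And>x. x \<in> N \<Longrightarrow> p' (g x) = g (p x)"
  proof (rule extend_bij_along_fibres[OF f, of N N' p p'])
    show "N \<inter> {r, u} = {}" "N' \<inter> {r', u'} = {}" "p ` N \<subseteq> {r, u}" "p' ` N' \<subseteq> {r', u'}"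
      using Ah Bh by (auto simp: N_def N'_def A.kids_def B.kids_def)
    fix y assume y: "y \<in> {r, u}"
    show "finite {x \<in> N. p x = y}" using y fin fib by auto
    show "finite {x \<in> N'. p' x = f y}" using y fin' fib' Ah by (auto simp: f_def)
    show "card {x \<in> N. p x = y} = card {x \<in> N'. p' x = f y}"
      using y Ah Bh A.card_root B.card_root A.card_hub B.card_hub A.hub B.hub fin fin'
      by (auto simp: f_def fib fib')
  qed blast
  have gN: "g x \<in> N'" if "x \<in> N" for x
  proof -
    have "x \<notin> {r, u}" using that Ah by (auto simp: N_def A.kids_def)
    then have "g x \<noteq> g r" "g x \<noteq> g u"
      using g(1) that by (auto simp: bij_betw_def inj_on_def)
    moreover have "g x \<in> {r', u'} \<union> N'" using g(1) that by (auto simp: bij_betw_def)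
    ultimately show ?thesis using g(2) Ah by (auto simp: f_def)
  qed
  define M where "M = pverts G - ({r, u} \<union> N)"
  define M' where "M' = pverts G' - ({r', u'} \<union> N')"
  have pM: "p x \<in> N" if "x \<in> M" for x
    using that A.deep[of x] by (auto simp: M_def N_def)
  have pM': "p' x \<in> N'" if "x \<in> M'" for x
    using that B.deep[of x] by (auto simp: M'_def N'_def)
  have NS: "r \<notin> N" "u \<notin> N" "r' \<notin> N'" "u' \<notin> N'"
    using Ah Bh by (auto simp: N_def N'_def A.kids_def B.kids_def)
  have fibM: "{x \<in> M. p x = y} = (if y \<in> N then A.kids y else {})" if "y \<in> {r, u} \<union> N" for y
    using that pM NS Ah by (auto simp: M_def N_def A.kids_def)
  have fibM': "{x \<in> M'. p' x = y} = (if y \<in> N' then B.kids y else {})" if "y \<in> {r', u'} \<union> N'" for y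
    using that pM' NS Bh by (auto simp: M'_def N'_def B.kids_def)
  have gS: "g y \<in> {r', u'} \<union> N'" if "y \<in> {r, u} \<union> N" for y
    using g(1) that by (auto simp: bij_betw_def)
  have gN_iff: "g y \<in> N' \<longleftrightarrow> y \<in> N" if "y \<in> {r, u} \<union> N" for y
    using that gN g(2) NS Ah by (auto simp: f_def)
  obtain e where e: "bij_betw e ({r, u} \<union> N \<union> M) ({r', u'} \<union> N' \<union> M')"
    "\<And>x. x \<in> {r, u} \<union> N \<Longrightarrow> e x = g x" "\<And>x. x \<in> M \<Longrightarrow> p' (e x) = e (p x)"
  proof (rule extend_bij_along_fibres[OF g(1), of M M' p p'])
    show "M \<inter> ({r, u} \<union> N) = {}" "M' \<inter> ({r', u'} \<union> N') = {}"
      "p ` M \<subseteq> {r, u} \<union> N" "p' ` M' \<subseteq> {r', u'} \<union> N'"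
      using pM pM' by (auto simp: M_def M'_def)
    fix y assume y: "y \<in> {r, u} \<union> N"
    show "finite {x \<in> M. p x = y}" using y fin by (simp add: fibM)
    show "finite {x \<in> M'. p' x = g y}" using gS[OF y] fin' by (simp add: fibM')
    show "card {x \<in> M. p x = y} = card {x \<in> M'. p' x = g y}"
      using A.card_inner[of y] B.card_inner[of "g y"] gN_iff[OF y]
      by (simp add: fibM[OF y] fibM'[OF gS[OF y]] N_def N'_def)
  qed blast
  have V: "{r, u} \<union> N \<union> M = pverts G" "{r', u'} \<union> N' \<union> M' = pverts G'"
    using Ah Bh A.root_in B.root_in by (auto simp: M_def M'_def N_def N'_def A.kids_def B.kids_def)
  show ?thesis
  proof (rule digraph_iso_parents[OF A.rooted_parents_axioms B.rooted_parents_axioms])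
    show "bij_betw e (pverts G) (pverts G')" using e(1) unfolding V .
    show "e r = r'" using e(2) g(2) by (simp add: f_def)
    fix x assume "x \<in> pverts G"
    then consider "x = r" | "x = u" | "x \<in> N" | "x \<in> M" using V by blast
    then show "p' (e x) = e (p x)"
    proof cases
      case 3
      then have "p x \<in> {r, u}" by (auto simp: N_def A.kids_def)
      with 3 show ?thesis using e(2) g(3) by auto
    qed (use e g Ah Bh A.parent_root B.parent_root in \<open>auto simp: f_def\<close>)
  qed
qed

section \<open>Multiplication by \<open>k\<close> modulo \<open>2k\<^sup>2\<close>\<close>

lemma mult_mod_double_square: "K * x mod (2 * K\<^sup>2) = K * (x mod (2 * K))" for K x :: int
  using mod_mult_mult1[of K x "2 * K"] by (simp add: power2_eq_square mult_ac)

text \<open>The interval of length \<open>2K\<^sup>2\<close> consists of \<open>K\<close> periods of length \<open>2K\<close>.\<close>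

lemma card_residue_class:
  fixes K m :: int
  assumes "0 \<le> m" "m < 2 * K"
  shows "card {x \<in> {0..<2 * K\<^sup>2}. x mod (2 * K) = m} = nat K"
proof -
  have K: "0 < K" using assms by linarith
  have "{x \<in> {0..<2 * K\<^sup>2}. x mod (2 * K) = m} = (\<lambda>t. m + 2 * K * t) ` {0..<K}"
  proof (intro equalityI subsetI)
    fix x assume x: "x \<in> {x \<in> {0..<2 * K\<^sup>2}. x mod (2 * K) = m}"
    have "x = m + 2 * K * (x div (2 * K))" using x by (auto simp: mult_div_mod_eq add.commute)
    moreover have "0 \<le> x div (2 * K)" using x K by (simp add: pos_imp_zdiv_nonneg_iff)
    moreover have "x div (2 * K) < K"
    proof (rule ccontr)
      assume "\<not> x div (2 * K) < K"
      then have "2 * K * K \<le> 2 * K * (x div (2 * K))" using K by (intro mult_left_mono) auto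
      moreover have "x < 2 * K * K" using x by (simp add: power2_eq_square)
      ultimately show False using \<open>x = m + _\<close> assms(1) by linarith
    qed
    ultimately show "x \<in> (\<lambda>t. m + 2 * K * t) ` {0..<K}" by auto
  next
    fix x assume "x \<in> (\<lambda>t. m + 2 * K * t) ` {0..<K}"
    then obtain t where t: "x = m + 2 * K * t" "0 \<le> t" "t \<le> K - 1" by auto
    have "2 * K * t \<le> 2 * K * (K - 1)" using t K by (intro mult_left_mono) auto
    then have "x < 2 * K\<^sup>2" using t assms by (simp add: power2_eq_square algebra_simps)
    then show "x \<in> {x \<in> {0..<2 * K\<^sup>2}. x mod (2 * K) = m}" using t assms K by auto
  qed
  moreover have "inj_on (\<lambda>t. m + 2 * K * t) {0..<K}" using K by (auto simp: inj_on_def)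
  ultimately show ?thesis by (simp add: card_image)
qed

text \<open>
  Multiplication by \<open>k\<close> modulo \<open>2k\<^sup>2\<close> appears as \<open>k * (x mod (2 * k))\<close>, from which the fibres can
  be read off.
\<close>

lemma branched_tree_rG_Z:
  assumes "even k" "3 \<le> k"
  shows "branched_tree (rG_Z k (2 * k\<^sup>2)) 0 (\<lambda>x. int k * (x mod (2 * int k))) ((int k)\<^sup>2) k"
proof -
  define K where "K = int k"
  have K: "3 \<le> K" "even K" "nat K = k" using assms by (auto simp: K_def)
  define V where "V = {0..<2 * K\<^sup>2}"
  define p where "p x = K * (x mod (2 * K))" for x
  define G where "G = rG_Z k (2 * k\<^sup>2)"
  have V: "pverts G = V" by (simp add: G_def rG_Z_def V_def K_def)
  have p_in: "p x \<in> V" for x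
    using K pos_mod_bound[of "2 * K" x] by (auto simp: p_def V_def power2_eq_square)
  have cong: "[int k * x = y] (mod int (2 * k\<^sup>2)) \<longleftrightarrow> y = p x" if "y \<in> V" for x y
    using that mult_mod_double_square[of K x] by (auto simp: cong_def p_def V_def K_def)
  have pp: "p (p x) = K\<^sup>2 * (x mod 2)" for x
  proof -
    have "K * (x mod (2 * K)) mod (2 * K) = K * (x mod (2 * K) mod 2)"
      using mod_mult_mult1[of K "x mod (2 * K)" 2] by (simp add: mult_ac)
    also have "x mod (2 * K) mod 2 = x mod 2" by (simp add: mod_mod_cancel)
    finally show ?thesis by (simp add: p_def power2_eq_square)
  qed
  have pp_cases: "p (p x) = 0 \<or> p (p x) = K\<^sup>2" for x
    using pp[of x] by (cases "even x") (auto simp: even_iff_mod_2_eq_zero odd_iff_mod_2_eq_one)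
  \<comment> \<open>A nonzero fixed point would give a loop in the parent graph, which \<open>rG_Z\<close> excludes.\<close>
  have fixed: "x = 0" if "p x = x" for x
  proof -
    have "x = K\<^sup>2 * (x mod 2)" using pp[of x] that by simp
    moreover from this have "even x" using K(2) by (metis dvd_mult2 even_power pos2)
    ultimately show ?thesis by (simp add: even_iff_mod_2_eq_zero)
  qed
  have p0: "p 0 = 0" by (simp add: p_def)
  interpret rooted_parents G 0 p
  proof
    show "0 \<in> pverts G" using K by (simp add: V V_def)
    show "p 0 = 0" by (fact p0)
    show "p x \<in> pverts G" if "x \<in> pverts G" for x using p_in V by simp
    have "parcs G = {(x, y). x \<in> V \<and> y \<in> V \<and> x \<noteq> y \<and> (y = p x \<or> x = p y)}"
      using cong V by (auto simp: G_def rG_Z_def)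
    also have "\<dots> = {(x, y). x \<in> pverts G \<and> y \<in> pverts G \<and> (x \<noteq> 0 \<and> y = p x \<or> y \<noteq> 0 \<and> x = p y)}"
      using fixed p0 unfolding V by (auto; metis)
    finally show "parcs G = \<dots>" .
  qed
  have fibre: "card {x \<in> V. p x = K * m} = k" if "0 \<le> m" "m < 2 * K" for m
    using card_residue_class[OF that] K by (simp add: p_def V_def)
  have card_kids: "card (kids v) = k" if v: "v \<in> V" "v \<noteq> 0" "K dvd v" for v
  proof -
    obtain m where m: "v = K * m" using v by blast
    have "0 \<le> m" "m < 2 * K"
      using v(1) K(1) unfolding m V_def by (auto simp: power2_eq_square zero_le_mult_iff)
    moreover have "kids v = {x \<in> V. p x = K * m}"
      using v p0 by (auto simp: kids_def V m)
    ultimately show ?thesis using fibre by simp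
  qed
  have dvd: "K dvd v" if "p v = 0 \<or> p v = K\<^sup>2" for v
  proof -
    have "v mod (2 * K) = 0 \<or> v mod (2 * K) = K"
      using that K(1) by (auto simp: p_def power2_eq_square)
    then have "K dvd v mod (2 * K)" by auto
    then show ?thesis by (simp add: dvd_mod_iff)
  qed
  have hub: "K\<^sup>2 \<in> V" "K\<^sup>2 \<noteq> 0" "K dvd K\<^sup>2" "p (K\<^sup>2) = 0"
    using K by (auto simp: V_def p_def power2_eq_square)
  have "branched_tree G 0 p (K\<^sup>2) k"
  proof
    show "3 \<le> k" by (fact assms)
    show "K\<^sup>2 \<in> kids 0" using hub by (simp add: kids_def V)
    have "kids 0 = {x \<in> V. p x = K * 0} - {0}" by (auto simp: kids_def V)
    then show "card (kids 0) = k - 1"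
      using fibre[of 0] K p0 by (simp add: V_def)
    show "card (kids (K\<^sup>2)) = k" using card_kids hub by blast
    show "card (kids v) = k" if "v \<in> kids 0 - {K\<^sup>2} \<union> kids (K\<^sup>2)" for v
      using that dvd by (intro card_kids) (auto simp: kids_def V)
    show "p x \<in> kids 0 - {K\<^sup>2} \<union> kids (K\<^sup>2)"
      if "x \<in> pverts G - {0}" "x \<notin> kids 0 \<union> kids (K\<^sup>2)" for x
      using that p_in[of x] pp_cases[of x] by (auto simp: kids_def V)
  qed
  then show ?thesis by (simp add: G_def K_def p_def[abs_def])
qed

section \<open>The parent map of a rooted tree\<close>

locale rooted_tree = pair_bidirected_digraph T for T :: "'a pair_pre_digraph" +
  fixes r :: 'a
  assumes root_in: "r \<in> pverts T"
    and connected: "Digraph_Component.connected (with_proj T)"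
    and acyclic: "cycle c \<Longrightarrow> length c < 3"
begin

text \<open>
  Otherwise a path from \<open>a\<close> to \<open>b\<close> that avoids \<open>w\<close> would close up through \<open>w\<close> to a cycle of
  length at least 3.
\<close>

lemma walk_between_neighbours:
  assumes q: "awalk a q b" and arcs: "(a, w) \<in> parcs T" "(b, w) \<in> parcs T" and "a \<noteq> b"
  shows "w \<in> set (awalk_verts a q)"
proof (rule ccontr)
  assume w: "w \<notin> set (awalk_verts a q)"
  define q' where "q' = awalk_to_apath q"
  have q': "apath a q' b" unfolding q'_def using q by (rule apath_awalk_to_apath)
  then have walk: "awalk a q' b" by (rule awalkI_apath)
  have "set q' \<subseteq> set q" unfolding q'_def using q by (rule awalk_to_apath_subset)
  then have w': "w \<notin> set (awalk_verts a q')"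
    using w unfolding set_awalk_verts[OF walk] set_awalk_verts[OF q] by auto
  have "q' \<noteq> []" using walk \<open>a \<noteq> b\<close> by (auto simp: awalk_Nil_iff)
  have last: "awalk b [(b, w)] w" using arcs(2) arc_implies_awalk by fastforce
  have "awalk a (q' @ [(b, w)]) w" using walk last by (rule awalk_appendI)
  moreover from this have "awalk_verts a (q' @ [(b, w)]) = awalk_verts a q' @ [w]"
    using walk by (simp add: awalk_verts_append)
  ultimately have "cycle ((w, a) # q' @ [(b, w)])"
    using q' w' arcs_symmetric[OF arcs(1)] unfolding cycle_def
    by (intro exI[of _ w]) (simp add: awalk_Cons_iff apath_def)
  then have "length ((w, a) # q' @ [(b, w)]) < 3" by (rule acyclic)
  then show False using \<open>q' \<noteq> []\<close> by simp
qed

lemma last_in_awalk_verts: "awalk x q y \<Longrightarrow> y \<in> set (awalk_verts x q)"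
  using last_in_set[OF awalk_verts_non_Nil[of x q]] by (simp add: awlast_of_awalk)

lemma apath_snoc_iff:
  "apath x (q @ [(a, b)]) y \<longleftrightarrow>
     b = y \<and> apath x q a \<and> (a, b) \<in> parcs T \<and> b \<notin> set (awalk_verts x q)"
proof
  assume "apath x (q @ [(a, b)]) y"
  then have q: "apath x q (awlast x q)" and e: "apath (awlast x q) [(a, b)] y"
    and disj: "set (awalk_verts x q) \<inter> set (tl (awalk_verts (awlast x q) [(a, b)])) = {}"
    using apath_append_iff[of x q "[(a, b)]" y] by simp_all
  from e have "awlast x q = a" "(a, b) \<in> parcs T" "b = y"
    by (auto simp: apath_Cons_iff apath_Nil_iff)
  then show "b = y \<and> apath x q a \<and> (a, b) \<in> parcs T \<and> b \<notin> set (awalk_verts x q)"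
    using q disj by simp
next
  assume *: "b = y \<and> apath x q a \<and> (a, b) \<in> parcs T \<and> b \<notin> set (awalk_verts x q)"
  then have walk: "awalk x q a" by (blast intro: awalkI_apath)
  then have "awlast x q = a" by (simp add: awlast_of_awalk)
  moreover have "a \<noteq> b" using last_in_awalk_verts[OF walk] * by blast
  ultimately show "apath x (q @ [(a, b)]) y"
    using * in_arcsD2 unfolding apath_append_iff by (auto simp: apath_Cons_iff apath_Nil_iff)
qed

text \<open>
  If two paths from the root entered \<open>w\<close> from different vertices, going back along one and then
  forth along the other would join two neighbours of \<open>w\<close> without visiting \<open>w\<close>.
\<close>

lemma apath_unique: "apath r p w \<Longrightarrow> apath r q w \<Longrightarrow> p = q"
proof (induction p arbitrary: q w rule: rev_induct)
  case Nil
  then show ?case using apath_nonempty_ends by (auto simp: apath_Nil_iff)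
next
  case (snoc e p)
  obtain a where e: "e = (a, w)" and p: "apath r p a" "(a, w) \<in> parcs T" "w \<notin> set (awalk_verts r p)"
    using snoc.prems(1) by (cases e) (auto simp: apath_snoc_iff)
  have "q \<noteq> []" using apath_nonempty_ends[OF snoc.prems(1)] snoc.prems(2) by (auto simp: apath_Nil_iff)
  then obtain b q' where q: "q = q' @ [(b, w)]" and
      q': "apath r q' b" "(b, w) \<in> parcs T" "w \<notin> set (awalk_verts r q')"
    using snoc.prems(2) by (cases q rule: rev_cases) (auto simp: apath_snoc_iff)
  have walks: "awalk a (rev_path p) r" "awalk r q' b"
    using p(1) q'(1) by (auto intro: awalkI_apath)
  have "w \<notin> set (awalk_verts a (rev_path p @ q'))"
    using p q' walks awalk_verts_rev_path[OF awalkI_apath[OF p(1)]]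
    by (simp add: set_awalk_verts_append)
  moreover have "awalk a (rev_path p @ q') b" using walks by (rule awalk_appendI)
  ultimately have "a = b" using walk_between_neighbours p(2) q'(2) by blast
  then show ?case using snoc.IH[OF p(1)] q'(1) e q by blast
qed

lemma children_iff:
  "w \<in> children T r a \<longleftrightarrow> (\<exists>p. apath r p a \<and> (a, w) \<in> parcs T \<and> w \<notin> set (awalk_verts r p))"
  unfolding children_def by (simp add: apath_snoc_iff)

lemma apath_from_root:
  assumes "x \<in> pverts T"
  obtains p where "apath r p x"
proof -
  have "strongly_connected (with_proj T)"
    using sym_arcs connected by (rule symmetric_connected_imp_strongly_connected)
  then have "r \<rightarrow>\<^sup>*\<^bsub>with_proj T\<^esub> x"
    using root_in assms by (auto simp: strongly_connected_def)
  then show thesis using that reachable_apath by blast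
qed

text \<open>
  The path from the root to \<open>a\<close> is extended by the arc to \<open>b\<close>, or else it visits \<open>b\<close>; then its
  initial part up to \<open>b\<close> misses \<open>a\<close> and is extended by the arc to \<open>a\<close>.
\<close>

lemma arc_children:
  assumes "(a, b) \<in> parcs T"
  shows "b \<in> children T r a \<or> a \<in> children T r b"
proof -
  obtain p where p: "apath r p a" using apath_from_root in_arcsD1[OF assms] by blast
  show ?thesis
  proof (cases "b \<in> set (awalk_verts r p)")
    case True
    obtain s t where st: "p = s @ t" "awalk r s b" "awalk b t a"
      using awalk_decomp[OF awalkI_apath[OF p] True] by blast
    have s: "apath r s b" and disj: "set (awalk_verts r s) \<inter> set (tl (awalk_verts b t)) = {}"
      using p st by (auto simp: apath_append_iff)
    have "a \<noteq> b" using assms no_loops by fastforce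
    then have "a \<in> set (tl (awalk_verts b t))"
      using st(3) by (cases t) (auto simp: awalk_simps dest: last_in_awalk_verts)
    then show ?thesis using s disj arcs_symmetric[OF assms] by (auto simp: children_iff)
  next
    case False
    then show ?thesis using p assms by (auto simp: children_iff)
  qed
qed

lemma children_asym: "b \<in> children T r a \<Longrightarrow> a \<notin> children T r b"
proof
  assume "b \<in> children T r a" "a \<in> children T r b"
  then obtain p q where p: "apath r p a" "(a, b) \<in> parcs T" "b \<notin> set (awalk_verts r p)"
    and q: "apath r q b" "a \<notin> set (awalk_verts r q)"
    by (auto simp: children_iff)
  have "q = p @ [(a, b)]" using p q(1) by (intro apath_unique) (auto simp: apath_snoc_iff)
  then show False using q(2) by (auto simp: awalk_verts_conv)
qed

lemma children_unique: "w \<in> children T r a \<Longrightarrow> w \<in> children T r b \<Longrightarrow> a = b"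
  unfolding children_def using apath_unique by fastforce

lemma children_arc: "w \<in> children T r a \<Longrightarrow> (a, w) \<in> parcs T"
  by (auto simp: children_iff)

lemma root_not_child: "r \<notin> children T r a"
  unfolding children_def using apath_nonempty_ends by blast

lemma child_of_some:
  assumes "x \<in> pverts T" "x \<noteq> r"
  obtains a where "x \<in> children T r a"
proof -
  obtain p where p: "apath r p x" using apath_from_root assms(1) .
  then have "p \<noteq> []" using assms(2) by (auto simp: apath_Nil_iff)
  then obtain q a b where "p = q @ [(a, b)]" by (metis rev_exhaust surj_pair)
  then show thesis using p that unfolding children_iff by (metis apath_snoc_iff)
qed

definition parent :: "'a \<Rightarrow> 'a" where
  "parent x = (if x = r then r else THE a. x \<in> children T r a)"

lemma parent_eq: "x \<in> children T r a \<Longrightarrow> parent x = a"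
  unfolding parent_def using children_unique root_not_child by (auto intro: the_equality)

lemma children_parent: "x \<in> pverts T \<Longrightarrow> x \<noteq> r \<Longrightarrow> x \<in> children T r (parent x)"
  using child_of_some parent_eq by metis

sublocale rooted_parents T r parent
proof
  show "r \<in> pverts T" by (fact root_in)
  show "parent r = r" by (simp add: parent_def)
  show "parent x \<in> pverts T" if "x \<in> pverts T" for x
    using that root_in children_arc[OF children_parent[OF that]] in_arcsD1
    by (cases "x = r") (auto simp: parent_def)
  have "(x, y) \<in> parcs T \<longleftrightarrow> x \<in> pverts T \<and> y \<in> pverts T \<and>
    (x \<noteq> r \<and> y = parent x \<or> y \<noteq> r \<and> x = parent y)" for x y
    using arc_children[of x y] children_arc children_parent parent_eq root_not_child
      arcs_symmetric in_arcsD1 in_arcsD2 by metis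
  then show "parcs T = {(x, y). x \<in> pverts T \<and> y \<in> pverts T \<and>
    (x \<noteq> r \<and> y = parent x \<or> y \<noteq> r \<and> x = parent y)}" by auto
qed

lemma kids_eq_children: "kids = children T r"
  unfolding kids_def
  using children_parent parent_eq root_not_child children_arc in_arcsD2 by (intro ext) blast

lemma gdegree_neighbours: "gdegree T v = card {w. (v, w) \<in> parcs T}"
proof -
  have "out_arcs (with_proj T) v = Pair v ` {w. (v, w) \<in> parcs T}" by auto
  then show ?thesis unfolding out_degree_def by (simp add: card_image inj_on_def)
qed

lemma gdegree_root: "gdegree T r = card (children T r r)"
proof -
  have "{w. (r, w) \<in> parcs T} = children T r r"
    using arc_children children_arc root_not_child by blast
  then show ?thesis by (simp add: gdegree_neighbours)
qed

text \<open>
  Positivity of the degree excludes infinitely many neighbours, for which the cardinality is \<open>0\<close>.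
\<close>

lemma gdegree_nonroot:
  assumes "v \<in> pverts T" "v \<noteq> r" "0 < gdegree T v"
  shows "finite (children T r v)" "gdegree T v = Suc (card (children T r v))"
proof -
  have eq: "{w. (v, w) \<in> parcs T} = insert (parent v) (children T r v)"
    using arc_children children_arc arcs_symmetric parent_eq children_parent[OF assms(1,2)] by blast
  have "finite {w. (v, w) \<in> parcs T}"
    using assms(3) unfolding gdegree_neighbours by (rule card_ge_0_finite)
  then show fin: "finite (children T r v)" unfolding eq by simp
  have "parent v \<notin> children T r v" using children_asym children_parent[OF assms(1,2)] by blast
  then show "gdegree T v = Suc (card (children T r v))"
    unfolding gdegree_neighbours eq using fin by simp
qed

end

section \<open>Trees with the prescribed degrees\<close>

theorem theorem3p17:
  fixes T :: "'a pair_pre_digraph" and v0 :: 'a and k :: nat and F :: "'a set"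
  assumes k: "even k" "4 \<le> k"
    and tree: "undirected_tree T"
    and root: "v0 \<in> pverts T" "gdegree T v0 = k - 1"
    and F_def: "F = {v \<in> pverts T. gdegree T v = k + 1}"
    and card_F: "card F = 2 * k - 1"
    and branch: "\<exists>u\<in>F. card (children T v0 u \<inter> F) = k"
    and root_nbrs: "\<forall>v. (v0, v) \<in> parcs T \<longrightarrow> gdegree T v = k + 1"
    and leaves: "\<forall>v\<in>pverts T. v \<noteq> v0 \<and> v \<notin> F \<longrightarrow> gdegree T v = 1"
  shows "digraph_iso (with_proj T) (with_proj (rG_Z k (2 * k ^ 2))) \<and> diameter T = 5"
proof -
  interpret pair_bidirected_digraph T using tree by (simp add: undirected_tree_def)
  interpret rooted_tree T v0
    using tree root by unfold_locales (auto simp: undirected_tree_def not_le[symmetric])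
  have F0: "v0 \<notin> F" using root(2) by (auto simp: F_def)
  have cardF: "finite (children T v0 v)" "card (children T v0 v) = k" if "v \<in> F" for v
    using that gdegree_nonroot[of v] F0 by (auto simp: F_def)
  obtain u where u: "u \<in> F" "card (children T v0 u \<inter> F) = k" using branch by blast
  have hub_sub: "children T v0 u \<subseteq> F"
    using card_subset_eq[OF cardF(1)[OF u(1)], of "children T v0 u \<inter> F"] u cardF(2) by auto
  have root_sub: "children T v0 v0 \<subseteq> F"
    unfolding F_def using root_nbrs children_arc in_arcsD2 by blast
  have disj: "children T v0 v0 \<inter> children T v0 u = {}"
    using children_unique[of _ v0 u] u(1) F0 by auto
  have finF: "finite F" using card_F k by (intro card_ge_0_finite) simp
  have "card (children T v0 v0 \<union> children T v0 u) = card F"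
    using card_Un_disjoint[OF _ _ disj] finite_subset[OF root_sub finF] cardF[OF u(1)]
      gdegree_root root(2) card_F k by simp
  then have F_eq: "F = children T v0 v0 \<union> children T v0 u"
    using card_subset_eq[OF finF] root_sub hub_sub by (metis Un_least)
  have u_child: "u \<in> children T v0 v0"
    using u(1) F_eq children_asym[of u u] by blast
  have tree_T: "branched_tree T v0 parent u k"
  proof (unfold_locales, unfold kids_eq_children)
    show "3 \<le> k" using k by simp
    show "u \<in> children T v0 v0" by (fact u_child)
    show "card (children T v0 v0) = k - 1" using gdegree_root root(2) by simp
    show "card (children T v0 u) = k" using cardF(2)[OF u(1)] .
    show "card (children T v0 v) = k" if "v \<in> children T v0 v0 - {u} \<union> children T v0 u" for v
      using that F_eq cardF(2) by blast
    show "parent x \<in> children T v0 v0 - {u} \<union> children T v0 u"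
      if x: "x \<in> pverts T - {v0}" "x \<notin> children T v0 v0 \<union> children T v0 u" for x
    proof -
      have child: "x \<in> children T v0 (parent x)" using x children_parent by blast
      have in_T: "parent x \<in> pverts T" using x parent_in by blast
      have "parent x \<in> F"
      proof (rule ccontr)
        assume "parent x \<notin> F"
        moreover have "parent x \<noteq> v0" using child x by auto
        ultimately have "card (children T v0 (parent x)) = 0" "finite (children T v0 (parent x))"
          using leaves in_T gdegree_nonroot[of "parent x"] by auto
        then show False using child by simp
      qed
      moreover have "parent x \<noteq> u" using child x by auto
      ultimately show ?thesis using F_eq by blast
    qed
  qed
  show ?thesis
    using digraph_iso_branched_trees[OF tree_T branched_tree_rG_Z] branched_tree.diameter_5[OF tree_T] k
    by simp
qed

end
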